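(* Let $1\le p<\infty$, let $(X,d,\mu)$ be a Cheeger space for the exponent $p$, and let $\Gamma_p$ be the $\overline\Gamma$-limit of the localized functionals $E_{p,r_n}(\cdot,\cdot)$ along a sequence $r_n\to0^+$ for which it exists. There exist $C>0$ and $\Lambda>1$ such that $$\int_{B(x,R)}|f(y)-f_{B(x,R)}|^p\,d\mu(y)\le CR^p\int_{B(x,\Lambda R)}d\Gamma_p(f)$$ for any $f\in KS^{1,p}(X)$, $x\in X$ and $R>0$, where $\int_{B(x,\Lambda R)}d\Gamma_p(f)=\Gamma_p(f)(B(x,\Lambda R))$.
   Context: Cheeger space (for $1\le p<\infty$): a locally compact, complete metric space $(X,d)$ with a Radon measure $\mu$ such that, writing $B(x,r)=\{y:d(x,y)<r\}$: (VD) there is $C>0$ with $0<\mu(B(x,2r))\le C\mu(B(x,r))<\infty$ for all $x\in X$, $r>0$; (PI) there are $C>0$, $\lambda\ge1$ such that for every Lipschitz $f$ on $X$ and every ball $B(x,R)$, $\int_{B(x,R)}|f-f_{B(x,R)}|^p d\mu\le CR^p\int_{B(x,\lambda R)}(\mathrm{Lip} f)^p d\mu$, where $f_B=\frac1{\mu(B)}\int_B f\,d\mu$ and $(\mathrm{Lip} f)(y)=\limsup_{r\to0^+}\sup_{d(x,y)\le r}\frac{|f(x)-f(y)|}{r}$. Energies: for $r>0$, $f\in L^p(X,\mu)$ and $U\subset X$ open, $E_{p,r}(f,U)=\frac1{r^p}\int_U\frac1{\mu(B(x,r))}\int_{B(x,r)}|f(y)-f(x)|^p d\mu(y)d\mu(x)$.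 The Korevaar-Schoen space is $KS^{1,p}(X)=\{f\in L^p(X,\mu):\limsup_{r\to0^+}E_{p,r}(f,X)<\infty\}$. $U\Subset V$ means $\overline U$ is compact and $\overline U\subset V$; $\mathcal{O}$ is the family of open subsets of $X$. $\overline{\Gamma}$-convergence: $E_n\colon L^p(X,\mu)\times\mathcal{O}\to[-\infty,\infty]$ $\overline\Gamma$-converge to $E$ if (i) $E(f,U)\le\liminf_nE_n(f_n,U)$ for all $U\in\mathcal{O}$ whenever $f_n\to f$ strongly in $L^p$; (ii) for all $f$ and all $U\Subset V$ in $\mathcal{O}$ there is $f_n\to f$ in $L^p$ with $\limsup_nE_n(f_n,U)\le E(f,V)$; and $E$ is inner regular: $E(f,V)=\sup\{E(f,U):U\in\mathcal{O},U\Subset V\}$. Notation: $\Gamma_p(f)(U)=\Gamma_p(f,U)$. (The sequence $r_n$ is also taken so that $E_{p,r_n}(\cdot,X)$ $\Gamma$-converges in $L^p(X,\mu)$.) *)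

theory Defs
  imports "HOL-Analysis.Analysis"
begin

definition radon_measure :: "'a::t2_space measure \<Rightarrow> bool" where
  "radon_measure M \<longleftrightarrow>
     sets M = sets borel \<and>
     (\<forall>K. compact K \<longrightarrow> emeasure M K < \<infinity>) \<and>
     (\<forall>A\<in>sets borel. emeasure M A = (INF U\<in>{U. open U \<and> A \<subseteq> U}. emeasure M U)) \<and>
     (\<forall>U. open U \<longrightarrow> emeasure M U = (SUP K\<in>{K. compact K \<and> K \<subseteq> U}. emeasure M K))"

definition volume_doubling :: "'a::metric_space measure \<Rightarrow> bool" where
  "volume_doubling M \<longleftrightarrow>
     (\<exists>C>0::real. \<forall>x. \<forall>r>0.
        0 < emeasure M (ball x (2 * r)) \<and>
        emeasure M (ball x (2 * r)) \<le> ennreal C * emeasure M (ball x r) \<and>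
        ennreal C * emeasure M (ball x r) < \<infinity>)"

definition mean_value :: "'a measure \<Rightarrow> 'a set \<Rightarrow> ('a \<Rightarrow> real) \<Rightarrow> real" where
  "mean_value M B f = (LINT y:B|M. f y) / measure M B"

definition oscillation :: "'a measure \<Rightarrow> real \<Rightarrow> 'a set \<Rightarrow> ('a \<Rightarrow> real) \<Rightarrow> ennreal" where
  "oscillation M p B f = (\<integral>\<^sup>+y\<in>B. ennreal (\<bar>f y - mean_value M B f\<bar> powr p) \<partial>M)"

definition pointwise_Lip :: "('a::metric_space \<Rightarrow> real) \<Rightarrow> 'a \<Rightarrow> ennreal" where
  "pointwise_Lip f y =
     Limsup (at_right 0) (\<lambda>r. SUP x\<in>cball y r. ennreal (\<bar>f x - f y\<bar> / r))"

text \<open>The conversion to a real number loses nothing here: for an \<open>L\<close>-Lipschitz function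
  \<^term>\<open>pointwise_Lip f y\<close> is at most \<open>L\<close>, hence finite.\<close>

definition poincare_inequality :: "real \<Rightarrow> 'a::metric_space measure \<Rightarrow> bool" where
  "poincare_inequality p M \<longleftrightarrow>
     (\<exists>C>0::real. \<exists>\<Lambda>\<ge>1::real. \<forall>f :: 'a \<Rightarrow> real. (\<exists>L. L-lipschitz_on UNIV f) \<longrightarrow>
        (\<forall>x. \<forall>R>0.
           oscillation M p (ball x R) f
             \<le> ennreal (C * R powr p) *
               (\<integral>\<^sup>+y\<in>ball x (\<Lambda> * R). ennreal (enn2real (pointwise_Lip f y) powr p) \<partial>M)))"

definition cheeger_space :: "real \<Rightarrow> 'a::complete_space measure \<Rightarrow> bool" where
  "cheeger_space p M \<longleftrightarrow>
     locally compact (UNIV :: 'a set) \<and> radon_measure M \<and>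
     volume_doubling M \<and> poincare_inequality p M"

text \<open>Elements of \<open>L\<^sup>p\<close> are represented by Borel functions rather than by classes modulo
  almost everywhere equality. Convergence in \<open>L\<^sup>p\<close> does not distinguish representatives, and
  therefore neither does a functional that arises below as a \<open>\<Gamma>\<close>-limit.\<close>

definition Lp_space :: "real \<Rightarrow> 'a measure \<Rightarrow> ('a \<Rightarrow> real) set" where
  "Lp_space p M = {f \<in> borel_measurable M. (\<integral>\<^sup>+x. ennreal (\<bar>f x\<bar> powr p) \<partial>M) < \<infinity>}"

definition Lp_converges ::
    "real \<Rightarrow> 'a measure \<Rightarrow> (nat \<Rightarrow> 'a \<Rightarrow> real) \<Rightarrow> ('a \<Rightarrow> real) \<Rightarrow> bool" where
  "Lp_converges p M g f \<longleftrightarrow>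
     (\<forall>n. g n \<in> Lp_space p M) \<and> f \<in> Lp_space p M \<and>
     (\<lambda>n. \<integral>\<^sup>+x. ennreal (\<bar>g n x - f x\<bar> powr p) \<partial>M) \<longlonglongrightarrow> 0"

definition KS_energy ::
    "real \<Rightarrow> 'a::metric_space measure \<Rightarrow> real \<Rightarrow> ('a \<Rightarrow> real) \<Rightarrow> 'a set \<Rightarrow> ennreal" where
  "KS_energy p M r f U =
     ennreal (1 / r powr p) *
     (\<integral>\<^sup>+x\<in>U. (\<integral>\<^sup>+y\<in>ball x r. ennreal (\<bar>f y - f x\<bar> powr p) \<partial>M) / emeasure M (ball x r) \<partial>M)"

definition KS_space :: "real \<Rightarrow> 'a::metric_space measure \<Rightarrow> ('a \<Rightarrow> real) set" where
  "KS_space p M =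
     {f \<in> Lp_space p M. Limsup (at_right 0) (\<lambda>r. KS_energy p M r f UNIV) < \<infinity>}"

definition compactly_contained :: "'a::topological_space set \<Rightarrow> 'a set \<Rightarrow> bool" where
  "compactly_contained U V \<longleftrightarrow> compact (closure U) \<and> closure U \<subseteq> V"

definition gamma_converges ::
    "real \<Rightarrow> 'a measure \<Rightarrow> (nat \<Rightarrow> ('a \<Rightarrow> real) \<Rightarrow> ereal) \<Rightarrow> (('a \<Rightarrow> real) \<Rightarrow> ereal) \<Rightarrow> bool" where
  "gamma_converges p M F G \<longleftrightarrow>
     (\<forall>f g. Lp_converges p M g f \<longrightarrow> G f \<le> liminf (\<lambda>n. F n (g n))) \<and>
     (\<forall>f\<in>Lp_space p M. \<exists>g. Lp_converges p M g f \<and> limsup (\<lambda>n. F n (g n)) \<le> G f)"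

definition gamma_bar_converges ::
    "real \<Rightarrow> 'a::topological_space measure \<Rightarrow> (nat \<Rightarrow> ('a \<Rightarrow> real) \<Rightarrow> 'a set \<Rightarrow> ereal) \<Rightarrow>
     (('a \<Rightarrow> real) \<Rightarrow> 'a set \<Rightarrow> ereal) \<Rightarrow> bool" where
  "gamma_bar_converges p M F G \<longleftrightarrow>
     (\<forall>f g U. Lp_converges p M g f \<longrightarrow> open U \<longrightarrow> G f U \<le> liminf (\<lambda>n. F n (g n) U)) \<and>
     (\<forall>f\<in>Lp_space p M. \<forall>U V. open U \<longrightarrow> open V \<longrightarrow> compactly_contained U V \<longrightarrow>
        (\<exists>g. Lp_converges p M g f \<and> limsup (\<lambda>n. F n (g n) U) \<le> G f V)) \<and>
     (\<forall>f\<in>Lp_space p M. \<forall>V. open V \<longrightarrow>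
        G f V = (SUP U\<in>{U. open U \<and> compactly_contained U V}. G f U))"

end

theory Submission
  imports Defs
begin

text \<open>Average \<open>f\<close> at scale \<open>r\<close> with a tent kernel: \<open>h y\<close> is the mean of \<open>f\<close> weighted by
  \<open>max 0 (r / 2 - dist y z)\<close>. By doubling, both \<open>r * Lip h y\<close> and \<open>\<bar>h y - f y\<bar>\<close> are bounded by a constant
  times the mean of \<open>\<bar>f z - f y\<bar>\<close> over \<open>ball y r\<close>, so Jensen's inequality bounds the \<open>p\<close>-energy
  of \<open>h\<close> and the scaled \<open>L\<^sup>p\<close> distance from \<open>f\<close> to \<open>h\<close> by the Korevaar-Schoen energy at scale \<open>r\<close>.
  Applying the Poincare inequality to \<open>h\<close> gives one for the Korevaar-Schoen energy at every
  scale \<open>r \<le> R\<close>. It passes to the limit along a recovery sequence for \<open>f\<close> on a ball that is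
  compactly contained in a larger one, closed balls being compact by doubling and completeness.
  Truncating the recovery sequence at height \<open>n\<close> does not increase the energy and makes \<open>h\<close> globally
  Lipschitz.\<close>

section \<open>Powers and mean values\<close>

text \<open>No measurability of \<open>f\<close> is assumed: the space is not known to be second countable as a type,
  so the inner integral of the energy is not readily seen to be measurable in its centre.\<close>

lemma nn_integral_cmult_le:
  assumes "0 < c"
  shows "(\<integral>\<^sup>+x. ennreal c * f x \<partial>M) \<le> ennreal c * (\<integral>\<^sup>+x. f x \<partial>M)"
  unfolding nn_integral_def
proof (rule SUP_least, clarify)
  fix g assume g: "simple_function M g" "g \<le> (\<lambda>x. ennreal c * f x)"
  \<comment> \<open>Division by \<open>c\<close> turns a simple function below \<open>c * f\<close>
    into one below \<open>f\<close>, so each candidate in the supremum on the left is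
    \<open>c\<close> times a candidate on the right.\<close>
  let ?h = "\<lambda>x. ennreal (1 / c) * g x"
  have inv: "ennreal c * (ennreal (1 / c) * t) = t" "ennreal (1 / c) * (ennreal c * t) = t" for t
    using assms by (simp_all flip: ennreal_mult mult.assoc)
  have h: "simple_function M ?h" using g(1) by auto
  have "?h x \<le> f x" for x
    using mult_left_mono[of "g x" "ennreal c * f x" "ennreal (1 / c)"] g(2)
    by (simp add: le_fun_def inv)
  then have "?h \<in> {g. simple_function M g \<and> g \<le> f}" using h by (auto simp: le_fun_def)
  then have "integral\<^sup>S M ?h \<le> (SUP g\<in>{g. simple_function M g \<and> g \<le> f}. integral\<^sup>S M g)"
    by (rule SUP_upper)
  then have "ennreal c * integral\<^sup>S M ?h \<le> ennreal c * (SUP g\<in>{g. simple_function M g \<and> g \<le> f}. integral\<^sup>S M g)"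
    by (rule mult_left_mono) simp
  moreover have "ennreal c * integral\<^sup>S M ?h = integral\<^sup>S M g"
    using g(1) by (simp add: simple_integral_mult inv)
  ultimately show "integral\<^sup>S M g \<le> ennreal c * (SUP g\<in>{g. simple_function M g \<and> g \<le> f}. integral\<^sup>S M g)"
    by simp
qed

text \<open>A convex function lies above its tangents. Integrated over a ball with \<open>a\<close>
  the mean value, this yields Jensen's inequality.\<close>

lemma powr_above_tangent:
  fixes a t p :: real
  assumes "1 \<le> p" "0 < a" "0 \<le> t"
  shows "a powr p + p * a powr (p - 1) * (t - a) \<le> t powr p"
\<comment> \<open>Convexity is used on the open half-line, so the end point is computed separately:
  there the tangent has the value (1 - p) a^p, which is at most 0.\<close>
proof (cases "t = 0")
  case True
  have e: "a powr (p - 1) * a = a powr p" using assms powr_add[of a "p - 1" 1] by simp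
  have "a powr p + p * a powr (p - 1) * (t - a) = a powr p - p * (a powr (p - 1) * a)"
    by (simp add: True)
  also have "\<dots> = (1 - p) * a powr p" unfolding e by (simp add: left_diff_distrib)
  also have "\<dots> \<le> 0" using assms(1) by (intro mult_nonpos_nonneg) auto
  also have "0 \<le> t powr p" by simp
  finally show ?thesis .
next
  case False
  have d: "((\<lambda>x. x powr p) has_real_derivative p * a powr (p - 1)) (at a within {0<..})"
    using assms by (metis has_field_derivative_at_within has_real_derivative_powr)
  have "p * a powr (p - 1) * (t - a) \<le> t powr p - a powr p"
    by (rule convex_on_imp_above_tangent[OF powr_convex[OF assms(1)] _ _ _ d]) (use False assms in \<open>auto simp: interior_open\<close>)
  then show ?thesis by linarith
qed

lemma mean_value_abs_nonneg: "0 \<le> mean_value M B (\<lambda>x. \<bar>f x\<bar>)"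
  unfolding mean_value_def set_lebesgue_integral_def by (auto intro!: divide_nonneg_nonneg integral_nonneg_AE)

text \<open>Jensen's inequality: integrate the tangent inequality at the mean value \<open>a\<close>
  of |f| over \<open>B\<close>; the linear term cancels.\<close>

lemma mean_value_powr_le:
  fixes f :: "'a \<Rightarrow> real"
  assumes p: "1 \<le> p" and f[measurable]: "f \<in> borel_measurable M" and B[measurable]: "B \<in> sets M"
    and pos: "0 < emeasure M B" and fin: "emeasure M B < \<infinity>"
  shows "ennreal (mean_value M B (\<lambda>x. \<bar>f x\<bar>) powr p)
     \<le> (\<integral>\<^sup>+x\<in>B. ennreal (\<bar>f x\<bar> powr p) \<partial>M) / emeasure M B"
proof -
  define a where "a = mean_value M B (\<lambda>x. \<bar>f x\<bar>)"
  define V where "V = measure M B"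
  have eV: "emeasure M B = ennreal V"
    unfolding V_def using fin by (intro emeasure_eq_ennreal_measure) (simp add: less_top)
  then have V: "0 < V" "emeasure M B = ennreal V" using pos by (simp_all add: ennreal_less_zero_iff)
  have "0 \<le> a" unfolding a_def by (rule mean_value_abs_nonneg)
  show ?thesis
  \<comment> \<open>These are the degenerate cases. The first includes functions that are not
    integrable over \<open>B\<close>, since their Bochner integral is 0 by convention.\<close>
  proof (cases "a = 0 \<or> (\<integral>\<^sup>+x\<in>B. ennreal (\<bar>f x\<bar> powr p) \<partial>M) = \<infinity>")
    case True
    then show ?thesis
    proof
      assume "a = 0"
      then show ?thesis by (simp add: a_def)
    next
      assume "(\<integral>\<^sup>+x\<in>B. ennreal (\<bar>f x\<bar> powr p) \<partial>M) = \<infinity>"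
      then show ?thesis by (simp add: eV ennreal_top_divide)
    qed
  next
    case False
    then have a: "0 < a" and fp: "(\<integral>\<^sup>+x\<in>B. ennreal (\<bar>f x\<bar> powr p) \<partial>M) < \<infinity>"
      using \<open>0 \<le> a\<close> by (auto simp: less_top)
    have int1: "integrable M (\<lambda>x. indicat_real B x * \<bar>f x\<bar>)"
    proof (rule ccontr)
      assume "\<not> ?thesis"
      then have "a = 0" by (simp add: a_def mean_value_def set_lebesgue_integral_def not_integrable_integral_eq)
      then show False using a by simp
    qed
    have intp: "integrable M (\<lambda>x. indicat_real B x * \<bar>f x\<bar> powr p)"
    proof (rule integrableI_nonneg)
      have "(\<integral>\<^sup>+x. ennreal (indicat_real B x * \<bar>f x\<bar> powr p) \<partial>M) = (\<integral>\<^sup>+x\<in>B. ennreal (\<bar>f x\<bar> powr p) \<partial>M)"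
        by (intro nn_integral_cong) (auto simp: indicator_def)
      then show "(\<integral>\<^sup>+x. ennreal (indicat_real B x * \<bar>f x\<bar> powr p) \<partial>M) < \<infinity>" using fp by simp
    qed auto
    have int0: "integrable M (indicat_real B)" using fin by simp
    have aV: "(\<integral>x. indicat_real B x * \<bar>f x\<bar> \<partial>M) = a * V"
      using V by (simp add: a_def mean_value_def set_lebesgue_integral_def V_def)
    have i0: "(\<integral>x. indicat_real B x \<partial>M) = V" using fin by (simp add: V_def)
    have "(\<integral>x. (a powr p - p * a powr (p - 1) * a) * indicat_real B x
        + p * a powr (p - 1) * (indicat_real B x * \<bar>f x\<bar>) \<partial>M) \<le> (\<integral>x. indicat_real B x * \<bar>f x\<bar> powr p \<partial>M)"
    proof (rule integral_mono)
      fix x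
      show "(a powr p - p * a powr (p - 1) * a) * indicat_real B x
        + p * a powr (p - 1) * (indicat_real B x * \<bar>f x\<bar>) \<le> indicat_real B x * \<bar>f x\<bar> powr p"
        using powr_above_tangent[OF p a, of "\<bar>f x\<bar>"] by (simp add: indicator_def algebra_simps)
    qed (use int0 int1 intp in auto)
    also have "(\<integral>x. (a powr p - p * a powr (p - 1) * a) * indicat_real B x
        + p * a powr (p - 1) * (indicat_real B x * \<bar>f x\<bar>) \<partial>M)
        = (a powr p - p * a powr (p - 1) * a) * V + p * a powr (p - 1) * (a * V)"
      using int0 int1 by (subst Bochner_Integration.integral_add) (simp_all add: aV i0 V_def[symmetric])
    also have "\<dots> = a powr p * V" by (simp add: left_diff_distrib)
    finally have "ennreal (a powr p * V) \<le> ennreal (\<integral>x. indicat_real B x * \<bar>f x\<bar> powr p \<partial>M)"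
      by (rule ennreal_leI)
    also have "\<dots> = (\<integral>\<^sup>+x. ennreal (indicat_real B x * \<bar>f x\<bar> powr p) \<partial>M)"
      by (rule nn_integral_eq_integral[symmetric, OF intp]) auto
    also have "\<dots> = (\<integral>\<^sup>+x\<in>B. ennreal (\<bar>f x\<bar> powr p) \<partial>M)"
      by (intro nn_integral_cong) (auto simp: indicator_def)
    finally have "ennreal (a powr p * V) / ennreal V \<le> (\<integral>\<^sup>+x\<in>B. ennreal (\<bar>f x\<bar> powr p) \<partial>M) / ennreal V"
      by (rule divide_right_mono_ennreal)
    then show ?thesis using V by (simp add: a_def[symmetric] divide_ennreal)
  qed
qed

text \<open>Only differences with one end at the fixed point \<open>y\<close>, at arbitrarily small
  distance, enter the upper limit. Hence \<open>a\<close> may depend on \<open>y\<close>.\<close>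

lemma pointwise_Lip_le:
  assumes "0 < \<rho>" "0 \<le> a" and lip: "\<And>y'. dist y y' < \<rho> \<Longrightarrow> \<bar>h y' - h y\<bar> \<le> a * dist y y'"
  shows "pointwise_Lip h y \<le> ennreal a"
  unfolding pointwise_Lip_def
proof (rule Limsup_bounded)
  have "\<forall>\<^sub>F r in at_right 0. 0 < r \<and> r < \<rho>"
    using assms(1) by (auto simp: eventually_at_right intro: exI[of _ \<rho>])
  then show "\<forall>\<^sub>F r in at_right 0. (SUP x\<in>cball y r. ennreal (\<bar>h x - h y\<bar> / r)) \<le> ennreal a"
  proof eventually_elim
    case (elim r)
    show ?case
    proof (intro SUP_least ennreal_leI)
      fix x assume "x \<in> cball y r"
      then have x: "dist y x \<le> r" by simp
      then have "\<bar>h x - h y\<bar> \<le> a * dist y x" using elim by (intro lip) auto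
      also have "\<dots> \<le> a * r" using x assms by (intro mult_left_mono) auto
      finally show "\<bar>h x - h y\<bar> / r \<le> a" using elim by (simp add: pos_divide_le_eq)
    qed
  qed
qed

text \<open>The sum is at most four times its largest term. Four is the number of differences into
  which \<open>oscillation_le_KS_energy\<close> splits; a shorter sum is padded with zeros.\<close>

lemma powr_sum4_le:
  fixes a b c d p :: real
  assumes "0 \<le> p" "0 \<le> a" "0 \<le> b" "0 \<le> c" "0 \<le> d"
  shows "(a + b + c + d) powr p \<le> 4 powr p * (a powr p + b powr p + c powr p + d powr p)"
proof -
  define m where "m = Max {a, b, c, d}"
  have m: "a \<le> m" "b \<le> m" "c \<le> m" "d \<le> m" "m \<in> {a, b, c, d}"
    unfolding m_def using Max_in[of "{a, b, c, d}"] by auto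
  have "(a + b + c + d) powr p \<le> (4 * m) powr p"
    using m assms by (intro powr_mono2) auto
  also have "\<dots> = 4 powr p * m powr p" using m assms by (intro powr_mult)
  also have "m powr p \<le> a powr p + b powr p + c powr p + d powr p"
    using m(5) by auto
  finally show ?thesis by simp
qed

section \<open>Truncation and L^p estimates\<close>

definition clip :: "real \<Rightarrow> real \<Rightarrow> real" where
  "clip N t = max (- N) (min N t)"

lemma clip_measurable [measurable]: "clip N \<in> borel_measurable borel"
  unfolding clip_def[abs_def] by measurable

lemma abs_clip_le: "0 \<le> N \<Longrightarrow> \<bar>clip N t\<bar> \<le> N"
  by (auto simp: clip_def)

lemma clip_contraction: "\<bar>clip N s - clip N t\<bar> \<le> \<bar>s - t\<bar>"
  by (auto simp: clip_def max_def min_def)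

lemma clip_error_le: "0 \<le> N \<Longrightarrow> \<bar>t - clip N t\<bar> \<le> \<bar>t\<bar>"
  by (auto simp: clip_def max_def min_def)

lemma KS_energy_clip_le:
  assumes "0 \<le> p"
  shows "KS_energy p M r (\<lambda>x. clip N (f x)) U \<le> KS_energy p M r f U"
  unfolding KS_energy_def
  by (intro mult_left_mono nn_integral_mono mult_right_mono divide_right_mono_ennreal ennreal_leI
      powr_mono2 clip_contraction assms abs_ge_zero) auto

text \<open>By Jensen, |m - c|^p is at most the mean of |f - c|^p, where m is the mean value of
  \<open>f\<close>. So m may be exchanged for any constant at the cost of a factor; the constant
  used later is the mean value of a smoothed function.\<close>

lemma oscillation_le:
  assumes p: "1 \<le> p" and f[measurable]: "f \<in> borel_measurable M" and B[measurable]: "B \<in> sets M"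
    and pos: "0 < emeasure M B" and fin: "emeasure M B < \<infinity>" and int: "set_integrable M B f"
  shows "oscillation M p B f \<le> ennreal (2 * 4 powr p) * (\<integral>\<^sup>+x\<in>B. ennreal (\<bar>f x - c\<bar> powr p) \<partial>M)"
proof -
  define V where "V = measure M B"
  have eV: "emeasure M B = ennreal V"
    unfolding V_def using fin by (intro emeasure_eq_ennreal_measure) (simp add: less_top)
  then have V: "0 < V" "emeasure M B = ennreal V" using pos by (simp_all add: ennreal_less_zero_iff)
  define J where "J = (\<integral>\<^sup>+x\<in>B. ennreal (\<bar>f x - c\<bar> powr p) \<partial>M)"
  define m where "m = mean_value M B f"
  have const: "set_integrable M B (\<lambda>x. c)" using fin by (simp add: set_integrable_def)
  have "(LINT x:B|M. f x - c) = (LINT x:B|M. f x) - (LINT x:B|M. c)"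
    using int const by (rule set_integral_diff)
  also have "(LINT x:B|M. c) = c * V"
    by (simp add: set_lebesgue_integral_def V_def sets.Int_space_eq2)
  finally have "m - c = (LINT x:B|M. f x - c) / V"
    using V(1) by (simp add: m_def mean_value_def V_def field_simps)
  also have "\<bar>\<dots>\<bar> \<le> (LINT x:B|M. \<bar>f x - c\<bar>) / V"
    using V(1) integral_abs_bound[of M "\<lambda>x. indicator B x *\<^sub>R (f x - c)"]
    by (simp add: set_lebesgue_integral_def abs_mult divide_right_mono)
  finally have "\<bar>m - c\<bar> powr p \<le> mean_value M B (\<lambda>x. \<bar>f x - c\<bar>) powr p"
    using p by (intro powr_mono2) (auto simp: mean_value_def V_def)
  then have "ennreal (\<bar>m - c\<bar> powr p) \<le> J / ennreal V"
    using mean_value_powr_le[OF p _ B pos fin, of "\<lambda>x. f x - c"] V(2)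
    by (simp add: J_def) (meson ennreal_leI order_trans)
  \<comment> \<open>Jensen's bound times the mass of \<open>B\<close>: the integral of the constant
    |m - c|^p over \<open>B\<close> is at most \<open>J\<close>. This is the source of the factor 2
    in the result.\<close>
  then have mc: "ennreal (\<bar>m - c\<bar> powr p) * ennreal V \<le> J"
    using mult_right_mono[of _ "J / ennreal V" "ennreal V"] V(1)
    by (fastforce simp: ennreal_divide_times)
  have "oscillation M p B f
     \<le> (\<integral>\<^sup>+x. ennreal (4 powr p) * (ennreal (\<bar>f x - c\<bar> powr p) * indicator B x + ennreal (\<bar>m - c\<bar> powr p) * indicator B x) \<partial>M)"
    unfolding oscillation_def m_def[symmetric]
  proof (rule nn_integral_mono)
    fix x
    have "\<bar>f x - m\<bar> powr p \<le> (\<bar>f x - c\<bar> + \<bar>m - c\<bar> + 0 + 0) powr p"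
      using p by (intro powr_mono2) auto
    also have "\<dots> \<le> 4 powr p * (\<bar>f x - c\<bar> powr p + \<bar>m - c\<bar> powr p + 0 powr p + 0 powr p)"
      using p by (intro powr_sum4_le) auto
    finally have "ennreal (\<bar>f x - m\<bar> powr p) \<le> ennreal (4 powr p) * (ennreal (\<bar>f x - c\<bar> powr p) + ennreal (\<bar>m - c\<bar> powr p))"
      by (simp add: ennreal_leI flip: ennreal_mult ennreal_plus)
    then show "ennreal (\<bar>f x - m\<bar> powr p) * indicator B x
      \<le> ennreal (4 powr p) * (ennreal (\<bar>f x - c\<bar> powr p) * indicator B x + ennreal (\<bar>m - c\<bar> powr p) * indicator B x)"
      by (simp add: indicator_def)
  qed
  also have "\<dots> = ennreal (4 powr p) * (J + ennreal (\<bar>m - c\<bar> powr p) * ennreal V)"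
    by (simp add: nn_integral_cmult nn_integral_add J_def nn_integral_cmult_indicator V(2))
  also have "\<dots> \<le> ennreal (4 powr p) * (J + J)"
    using mc by (intro mult_left_mono add_left_mono) auto
  also have "\<dots> = ennreal (2 * 4 powr p) * J"
    unfolding mult_2[symmetric] by (simp add: ennreal_mult mult_ac)
  finally show ?thesis by (simp add: J_def)
qed

text \<open>Since t <= 1 + t^p for p >= 1, the sum of the indicator of \<open>B\<close> and |f|^p is
  an integrable majorant.\<close>

lemma Lp_set_integrable:
  assumes p: "1 \<le> p" and f: "f \<in> Lp_space p M" and B[measurable]: "B \<in> sets M" and fin: "emeasure M B < \<infinity>"
  shows "set_integrable M B f"
proof -
  have [measurable]: "f \<in> borel_measurable M" and fp: "(\<integral>\<^sup>+x. ennreal (\<bar>f x\<bar> powr p) \<partial>M) < \<infinity>"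
    using f by (auto simp: Lp_space_def)
  have "integrable M (\<lambda>x. \<bar>f x\<bar> powr p)" using fp by (intro integrableI_nonneg) auto
  moreover have "integrable M (indicat_real B)" using fin by simp
  ultimately have "integrable M (\<lambda>x. indicat_real B x + \<bar>f x\<bar> powr p)" by simp
  moreover have "t \<le> 1 + t powr p" if "0 \<le> t" for t :: real
    using powr_mono[of 1 p t] p that powr_ge_zero[of t p] by (cases "1 \<le> t") (auto intro: add_increasing2)
  ultimately show ?thesis
    unfolding set_integrable_def
    by (elim Bochner_Integration.integrable_bound) (auto simp: indicator_def)
qed

text \<open>Dominated convergence with majorant |f|^p: at each \<open>x\<close> the error vanishes
  once n >= |f x|.\<close>

lemma nn_integral_clip_error_tendsto_0:
  assumes p: "1 \<le> p" and f: "f \<in> Lp_space p M"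
  shows "(\<lambda>n. \<integral>\<^sup>+x. ennreal (\<bar>f x - clip (real n) (f x)\<bar> powr p) \<partial>M) \<longlonglongrightarrow> 0"
proof -
  have [measurable]: "f \<in> borel_measurable M" and fp: "(\<integral>\<^sup>+x. ennreal (\<bar>f x\<bar> powr p) \<partial>M) < \<infinity>"
    using f by (auto simp: Lp_space_def)
  have "(\<lambda>n. \<integral>\<^sup>+x. ennreal (\<bar>f x - clip (real n) (f x)\<bar> powr p) \<partial>M) \<longlonglongrightarrow> (\<integral>\<^sup>+x. 0 \<partial>M)"
  proof (rule nn_integral_dominated_convergence[where w = "\<lambda>x. ennreal (\<bar>f x\<bar> powr p)"])
    show "AE x in M. ennreal (\<bar>f x - clip (real n) (f x)\<bar> powr p) \<le> ennreal (\<bar>f x\<bar> powr p)" for n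
      using p by (intro AE_I2 ennreal_leI powr_mono2 clip_error_le) auto
    show "AE x in M. (\<lambda>n. ennreal (\<bar>f x - clip (real n) (f x)\<bar> powr p)) \<longlonglongrightarrow> 0"
    proof (intro AE_I2 tendsto_eventually)
      fix x
      show "\<forall>\<^sub>F n in sequentially. ennreal (\<bar>f x - clip (real n) (f x)\<bar> powr p) = 0"
        using eventually_ge_at_top[of "nat \<lceil>\<bar>f x\<bar>\<rceil>"]
      proof eventually_elim
        case (elim n)
        then have "\<bar>f x\<bar> \<le> real n" by linarith
        then have "clip (real n) (f x) = f x" by (auto simp: clip_def max_def min_def)
        then show ?case by simp
      qed
    qed
  qed (use fp in auto)
  then show ?thesis by simp
qed

lemma KS_energy_mono:
  assumes "U \<subseteq> V"
  shows "KS_energy p M r f U \<le> KS_energy p M r f V"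
  unfolding KS_energy_def using assms
  by (intro mult_left_mono nn_integral_mono) (auto simp: indicator_def)

section \<open>Doubling measures\<close>

text \<open>Balls have finite mass, so \<open>measure\<close> keeps all information about them and
  ratios of masses become quotients of reals. With \<open>D\<close> at least 1 all its powers are
  positive.\<close>

locale doubling =
  fixes M :: "'a::metric_space measure" and D :: real
  assumes sets_eq[measurable_cong]: "sets M = sets borel"
    and D_ge: "1 \<le> D"
    and ball_pos: "0 < r \<Longrightarrow> 0 < emeasure M (ball x r)"
    and ball_finite: "emeasure M (ball x r) < \<infinity>"
    and doubling: "0 < r \<Longrightarrow> measure M (ball x (2 * r)) \<le> D * measure M (ball x r)"
begin

lemma space_eq: "space M = UNIV"
  using sets_eq_imp_space_eq[OF sets_eq] by simp

lemma emeasure_ball: "emeasure M (ball x r) = ennreal (measure M (ball x r))"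
  using ball_finite by (simp add: emeasure_eq_ennreal_measure less_top[symmetric])

lemma measure_ball_pos: "0 < r \<Longrightarrow> 0 < measure M (ball x r)"
  using ball_pos[of r x] by (simp add: emeasure_ball)

lemma measure_ball_mono: "ball x r \<subseteq> ball y s \<Longrightarrow> measure M (ball x r) \<le> measure M (ball y s)"
  using emeasure_mono[of "ball x r" "ball y s" M] by (simp add: emeasure_ball sets_eq)

lemma doubling_iterate: "0 < r \<Longrightarrow> measure M (ball x (2 ^ k * r)) \<le> D ^ k * measure M (ball x r)"
proof (induction k)
  case (Suc k)
  have "measure M (ball x (2 ^ Suc k * r)) \<le> D * measure M (ball x (2 ^ k * r))"
    using doubling[of "2 ^ k * r" x] Suc.prems by (simp add: mult.assoc)
  also have "\<dots> \<le> D * (D ^ k * measure M (ball x r))"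
    using Suc D_ge by (intro mult_left_mono) auto
  finally show ?case by (simp add: mult.assoc)
qed simp

lemma integrable_bounded_ball:
  fixes g :: "'a \<Rightarrow> real"
  assumes [measurable]: "g \<in> borel_measurable M"
    and bound: "\<And>z. \<bar>g z\<bar> \<le> N" and supp: "\<And>z. z \<notin> ball y r \<Longrightarrow> g z = 0"
  shows "integrable M g"
proof (rule Bochner_Integration.integrable_bound[where f = "\<lambda>z. N * indicat_real (ball y r) z"])
  show "integrable M (\<lambda>z. N * indicat_real (ball y r) z)"
    using ball_finite[of y r] by (auto simp: sets_eq)
  show "AE z in M. norm (g z) \<le> norm (N * indicat_real (ball y r) z)"
  proof (rule AE_I2)
    show "norm (g z) \<le> norm (N * indicat_real (ball y r) z)" for z
      using bound[of z] supp[of z] by (cases "z \<in> ball y r") auto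
  qed
qed simp

section \<open>Compactness of closed balls\<close>

text \<open>Packing argument: the balls of radius \<open>e / 2\<close> around the points of
  \<open>F\<close> are disjoint, lie in \<open>ball x (R + e)\<close>, and by iterated doubling each
  carries at least the fraction 1 / D^k of its mass.\<close>

lemma separated_card_bound:
  fixes x :: 'a
  assumes R: "0 < R" and e: "0 < e"
  shows "\<exists>N. \<forall>F. finite F \<longrightarrow> F \<subseteq> cball x R \<longrightarrow> (\<forall>y\<in>F. \<forall>z\<in>F. y \<noteq> z \<longrightarrow> e \<le> dist y z) \<longrightarrow> card F \<le> N"
proof -
  define W where "W = measure M (ball x (R + e))"
  \<comment> \<open>A point of \<open>ball x (R + e)\<close> is closer than \<open>2 * R + e\<close>
    to any centre in \<open>cball x R\<close>, so \<open>k\<close> doublings of radius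
    \<open>e / 2\<close> reach it.\<close>
  obtain k where k: "(2 * R + e) / (e / 2) < 2 ^ k" using real_arch_pow[of 2] by auto
  then have k: "2 * R + e < 2 ^ k * (e / 2)" using e by (simp add: field_simps)
  have W: "0 < W" unfolding W_def using R e by (intro measure_ball_pos) auto
  have Dk: "0 < D ^ k" using D_ge by auto
  show ?thesis
  proof (intro exI allI impI)
    fix F assume F: "finite F" "F \<subseteq> cball x R" "\<forall>y\<in>F. \<forall>z\<in>F. y \<noteq> z \<longrightarrow> e \<le> dist y z"
    have low: "W / D ^ k \<le> measure M (ball z (e / 2))" if "z \<in> F" for z
    proof -
      have "W \<le> measure M (ball z (2 ^ k * (e / 2)))"
        unfolding W_def
      proof (rule measure_ball_mono, rule subsetI)
        fix y assume "y \<in> ball x (R + e)"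
        then show "y \<in> ball z (2 ^ k * (e / 2))"
          using k that F(2) dist_triangle[of z y x] by (auto simp: dist_commute)
      qed
      also have "\<dots> \<le> D ^ k * measure M (ball z (e / 2))" using e by (intro doubling_iterate) auto
      finally show ?thesis using Dk by (simp add: field_simps)
    qed
    have disj: "disjoint_family_on (\<lambda>z. ball z (e / 2)) F"
    proof (unfold disjoint_family_on_def, intro ballI impI equals0I)
      fix y z w assume "y \<in> F" "z \<in> F" "y \<noteq> z" "w \<in> ball y (e / 2) \<inter> ball z (e / 2)"
      then show False using F(3) dist_triangle[of y z w] by (force simp: dist_commute)
    qed
    have "of_nat (card F) * (W / D ^ k) \<le> (\<Sum>z\<in>F. measure M (ball z (e / 2)))"
      using low by (rule sum_bounded_below)
    also have "\<dots> = measure M (\<Union>z\<in>F. ball z (e / 2))"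
      using ball_finite by (intro measure_finite_Union[symmetric] F disj) (auto simp: sets_eq less_top)
    also have "\<dots> \<le> W" unfolding W_def
    proof (rule measure_mono_fmeasurable)
      show "(\<Union>z\<in>F. ball z (e / 2)) \<subseteq> ball x (R + e)"
      proof clarify
        fix z y assume "z \<in> F" "y \<in> ball z (e / 2)"
        then show "y \<in> ball x (R + e)"
          using F(2) e dist_triangle[of x y z] by (auto simp: dist_commute)
      qed
    qed (use ball_finite F(1) in \<open>auto simp: sets_eq fmeasurable_def intro!: borel_open\<close>)
    finally have "real (card F) \<le> D ^ k" using W Dk by (simp add: field_simps)
    then show "card F \<le> nat \<lceil>D ^ k\<rceil>" by linarith
  qed
qed

text \<open>An e-separated subset of largest cardinality exists by the packing bound. It is an
  e-net, for a point at distance at least \<open>e\<close> from all its members could be added to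
  it.\<close>

lemma totally_bounded_cball:
  fixes x :: 'a
  assumes R: "0 < R" and e: "0 < e"
  shows "\<exists>F. finite F \<and> cball x R \<subseteq> (\<Union>z\<in>F. ball z e)"
proof -
  define P where "P F \<longleftrightarrow> finite F \<and> F \<subseteq> cball x R \<and> (\<forall>y\<in>F. \<forall>z\<in>F. y \<noteq> z \<longrightarrow> e \<le> dist y z)" for F
  obtain N where N: "\<And>F. P F \<Longrightarrow> card F \<le> N"
    using separated_card_bound[OF assms, of x] unfolding P_def imp_conjL by metis
  have "P {}" by (simp add: P_def)
  then obtain F where F: "P F" "\<And>G. P G \<Longrightarrow> card G \<le> card F"
    using ex_has_greatest_nat[of P "{}" card "Suc N"] N by (auto simp: less_Suc_eq_le)
  have "\<exists>z\<in>F. dist z y < e" if y: "y \<in> cball x R" for y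
  proof (rule ccontr)
    assume *: "\<not> ?thesis"
    then have far: "e \<le> dist z y" "e \<le> dist y z" if "z \<in> F" for z
      using that by (force simp: dist_commute not_less)+
    then have "y \<notin> F" using e by fastforce
    moreover have "P (insert y F)" using F(1) far y unfolding P_def by simp
    ultimately show False using F(2)[of "insert y F"] F(1) by (simp add: P_def)
  qed
  then show ?thesis using F(1) by (intro exI[of _ F]) (auto simp: P_def)
qed

end

text \<open>A complete and totally bounded set is compact. Completeness of the closed ball comes
  from the type class, which is stronger than that of the locale.\<close>

lemma doubling_compact_cball:
  fixes M :: "'a::complete_space measure"
  assumes "doubling M D"
  shows "compact (cball (x::'a) R)"
proof (cases "0 < R")
  case True
  interpret doubling M D by fact
  show ?thesis
    unfolding compact_eq_totally_bounded
    by (intro conjI allI impI totally_bounded_cball[OF True]) (simp_all add: complete_eq_closed)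
next
  case False
  have "y = x" if "y \<in> cball x R" for y
    using that False zero_le_dist[of x y] by (metis dist_le_zero_iff mem_cball not_less order_trans)
  then have "cball x R \<subseteq> {x}" by blast
  then show ?thesis
    by (meson finite.emptyI finite.insertI finite_imp_compact finite_subset)
qed

section \<open>Lipschitz smoothing\<close>

context doubling
begin

text \<open>The tent vanishes outside \<open>ball y \<rho>\<close> and is 1-Lipschitz in its centre
  \<open>y\<close>. This makes the averages Lipschitz, whereas plain means over balls need not even
  be continuous in the centre.\<close>

definition smooth_weight :: "real \<Rightarrow> 'a \<Rightarrow> real" where
  "smooth_weight \<rho> y = (\<integral>z. max 0 (\<rho> - dist y z) \<partial>M)"

definition smooth :: "real \<Rightarrow> ('a \<Rightarrow> real) \<Rightarrow> 'a \<Rightarrow> real" where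
  "smooth \<rho> f y = (\<integral>z. max 0 (\<rho> - dist y z) * f z \<partial>M) / smooth_weight \<rho> y"

lemma borel_measurable_tent [measurable]: "(\<lambda>z. max 0 (\<rho> - dist y z)) \<in> borel_measurable M"
proof -
  have "(\<lambda>z. max 0 (\<rho> - dist y z)) \<in> borel_measurable borel"
    by (intro borel_measurable_continuous_onI continuous_intros)
  then show ?thesis by simp
qed

text \<open>The tent at \<open>y'\<close> is at least \<open>\<rho> / 2\<close> on
  \<open>ball y' (\<rho> / 2)\<close>, and three doublings of that ball cover
  \<open>ball y (2 * \<rho>)\<close>. Admitting \<open>y'\<close> different from \<open>y\<close>
  lets the weights at two centres be compared with one ball.\<close>

lemma smooth_weight_lower:
  assumes "0 < \<rho>" "dist y y' < \<rho>"
  shows "\<rho> * measure M (ball y (2 * \<rho>)) \<le> 2 * D ^ 3 * smooth_weight \<rho> y'"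
proof -
  have "measure M (ball y (2 * \<rho>)) \<le> measure M (ball y' (2 ^ 3 * (\<rho> / 2)))"
  proof (rule measure_ball_mono, rule subsetI)
    fix z assume "z \<in> ball y (2 * \<rho>)"
    then show "z \<in> ball y' (2 ^ 3 * (\<rho> / 2))"
      using assms dist_triangle[of y' z y] by (simp add: dist_commute)
  qed
  also have "\<dots> \<le> D ^ 3 * measure M (ball y' (\<rho> / 2))" using assms by (intro doubling_iterate) auto
  finally have 1: "measure M (ball y (2 * \<rho>)) \<le> D ^ 3 * measure M (ball y' (\<rho> / 2))" .
  have "\<rho> / 2 * measure M (ball y' (\<rho> / 2)) = (\<integral>z. \<rho> / 2 * indicat_real (ball y' (\<rho> / 2)) z \<partial>M)"
    by (simp add: sets_eq space_eq)
  also have "\<dots> \<le> smooth_weight \<rho> y'" unfolding smooth_weight_def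
  proof (rule integral_mono)
    show "integrable M (\<lambda>z. max 0 (\<rho> - dist y' z))"
      using assms by (intro integrable_bounded_ball[of _ \<rho> y' \<rho>]) auto
    show "integrable M (\<lambda>z. \<rho> / 2 * indicat_real (ball y' (\<rho> / 2)) z)"
      using ball_finite[of y' "\<rho> / 2"] by (auto simp: sets_eq)
  qed (use assms in \<open>auto simp: indicator_def\<close>)
  finally have 2: "\<rho> * measure M (ball y' (\<rho> / 2)) \<le> 2 * smooth_weight \<rho> y'" by simp
  have "\<rho> * measure M (ball y (2 * \<rho>)) \<le> \<rho> * (D ^ 3 * measure M (ball y' (\<rho> / 2)))"
    using 1 assms by (intro mult_left_mono) auto
  also have "\<dots> = D ^ 3 * (\<rho> * measure M (ball y' (\<rho> / 2)))" by simp
  also have "\<dots> \<le> D ^ 3 * (2 * smooth_weight \<rho> y')"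
    using 2 D_ge by (intro mult_left_mono) auto
  finally show ?thesis by simp
qed

lemma smooth_weight_pos: "0 < \<rho> \<Longrightarrow> 0 < smooth_weight \<rho> y"
  using smooth_weight_lower[of \<rho> y y] measure_ball_pos[of "2 * \<rho>" y] D_ge
  by (smt (verit) dist_self mult_nonneg_nonpos mult_pos_pos zero_le_power)

text \<open>The normalisation reproduces constants, so \<open>c\<close> can be moved under the
  integral. It is applied with \<open>c\<close> equal to \<open>f y\<close>, also at centres other
  than \<open>y\<close>.\<close>

lemma smooth_minus_const:
  assumes [measurable]: "f \<in> borel_measurable M" and N: "\<And>z. \<bar>f z\<bar> \<le> N" and "0 < \<rho>"
  shows "smooth \<rho> f y - c = (\<integral>z. max 0 (\<rho> - dist y z) * (f z - c) \<partial>M) / smooth_weight \<rho> y"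
proof -
  have N0: "0 \<le> N" using N[of y] by linarith
  have i: "integrable M (\<lambda>z. max 0 (\<rho> - dist y z) * f z)"
    using assms N0 by (intro integrable_bounded_ball[of _ "\<rho> * N" y \<rho>])
      (auto simp: abs_mult intro!: mult_mono)
  have j: "integrable M (\<lambda>z. max 0 (\<rho> - dist y z))"
    using assms by (intro integrable_bounded_ball[of _ \<rho> y \<rho>]) auto
  have "(\<integral>z. max 0 (\<rho> - dist y z) * (f z - c) \<partial>M)
      = (\<integral>z. max 0 (\<rho> - dist y z) * f z \<partial>M) - c * smooth_weight \<rho> y"
    using i j by (simp add: right_diff_distrib smooth_weight_def mult.commute[of _ c])
  then show ?thesis using smooth_weight_pos[OF assms(3), of y] by (simp add: smooth_def field_simps)
qed


text \<open>The right side is \<open>a\<close> times the integral of |f - c| over the ball. The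
  kernels \<open>k\<close> to come are a tent, with \<open>a\<close> its height, and a difference of
  two tents, with \<open>a\<close> the distance of their centres.\<close>

lemma ball_integral_bound:
  assumes [measurable]: "f \<in> borel_measurable M" "k \<in> borel_measurable M"
    and N: "\<And>z. \<bar>f z\<bar> \<le> N" and "0 < r" and k: "\<And>z. \<bar>k z\<bar> \<le> a * indicat_real (ball y r) z"
  shows "\<bar>\<integral>z. k z * (f z - c) \<partial>M\<bar>
    \<le> a * (measure M (ball y r) * mean_value M (ball y r) (\<lambda>z. \<bar>f z - c\<bar>))"
proof -
  have a: "0 \<le> a" using k[of y] assms(4) by simp
  have k0: "k z = 0" if "z \<notin> ball y r" for z using k[of z] that by simp
  have ka: "\<bar>k z\<bar> \<le> a" for z
    using k[of z] a by (cases "z \<in> ball y r") auto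
  have fc: "\<bar>f z - c\<bar> \<le> N + \<bar>c\<bar>" for z using N[of z] by linarith
  have fc0: "0 \<le> N + \<bar>c\<bar>" using fc[of y] by linarith
  have [measurable]: "ball y r \<in> sets M" by (simp add: sets_eq)
  have i: "integrable M (\<lambda>z. k z * (f z - c))"
    using ka fc a by (intro integrable_bounded_ball[of _ "a * (N + \<bar>c\<bar>)" y r])
      (auto simp: abs_mult k0 intro!: mult_mono)
  have "\<bar>\<integral>z. k z * (f z - c) \<partial>M\<bar> \<le> (\<integral>z. \<bar>k z * (f z - c)\<bar> \<partial>M)"
    by (rule integral_abs_bound)
  also have "\<dots> \<le> (\<integral>z. a * (indicat_real (ball y r) z * \<bar>f z - c\<bar>) \<partial>M)"
  proof (rule integral_mono)
    show "integrable M (\<lambda>z. a * (indicat_real (ball y r) z * \<bar>f z - c\<bar>))"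
    proof (intro integrable_mult_right integrable_bounded_ball[of _ "N + \<bar>c\<bar>" y r])
      show "\<bar>indicat_real (ball y r) z * \<bar>f z - c\<bar>\<bar> \<le> N + \<bar>c\<bar>" for z
        using fc[of z] fc0 by (simp add: indicator_def)
    qed auto
    show "\<bar>k z * (f z - c)\<bar> \<le> a * (indicat_real (ball y r) z * \<bar>f z - c\<bar>)" for z
      using mult_right_mono[OF k[of z] abs_ge_zero[of "f z - c"]] by (simp add: abs_mult mult.assoc)
  qed (use i in simp)
  also have "\<dots> = a * (measure M (ball y r) * mean_value M (ball y r) (\<lambda>z. \<bar>f z - c\<bar>))"
    using measure_ball_pos[OF assms(4), of y] by (simp add: mean_value_def set_lebesgue_integral_def)
  finally show ?thesis .
qed

abbreviation ball_variation :: "('a \<Rightarrow> real) \<Rightarrow> 'a \<Rightarrow> real \<Rightarrow> real" where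
  "ball_variation f y r \<equiv> mean_value M (ball y r) (\<lambda>z. \<bar>f z - f y\<bar>)"

text \<open>This crude bound serves only to produce some global Lipschitz constant; the value of
  that constant does not enter the energy estimates.\<close>

lemma ball_variation_le:
  assumes [measurable]: "f \<in> borel_measurable M"
    and N: "\<And>z. \<bar>f z\<bar> \<le> N" and "0 < r"
  shows "ball_variation f y r \<le> 2 * N"
proof -
  have [measurable]: "ball y r \<in> sets M" by (simp add: sets_eq)
  have fc: "\<bar>f z - f y\<bar> \<le> 2 * N" for z using N[of z] N[of y] by linarith
  have N0: "0 \<le> N" using N[of y] by linarith
  have "(\<integral>z. indicat_real (ball y r) z * \<bar>f z - f y\<bar> \<partial>M) \<le> (\<integral>z. 2 * N * indicat_real (ball y r) z \<partial>M)"
  proof (rule integral_mono)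
    show "integrable M (\<lambda>z. indicat_real (ball y r) z * \<bar>f z - f y\<bar>)"
    proof (rule integrable_bounded_ball[of _ "2 * N" y r])
      show "\<bar>indicat_real (ball y r) z * \<bar>f z - f y\<bar>\<bar> \<le> 2 * N" for z
        using fc[of z] N0 by (simp add: indicator_def)
    qed auto
    show "integrable M (\<lambda>z. 2 * N * indicat_real (ball y r) z)"
      using ball_finite[of y r] by (auto simp: sets_eq)
  qed (use fc in \<open>auto simp: indicator_def\<close>)
  also have "\<dots> = 2 * N * measure M (ball y r)" by (simp add: sets_eq space_eq)
  finally show ?thesis using measure_ball_pos[OF assms(3), of y]
    by (simp add: mean_value_def set_lebesgue_integral_def field_simps)
qed

text \<open>Comparing with the constant \<open>f y\<close> at the centre, instead of a mean value, bounds both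
  quantities below by the mean whose \<open>p\<close>-th power the energy at \<open>y\<close> dominates, at the same scale \<open>2 * \<rho>\<close>.\<close>

lemma smooth_approx:
  assumes f: "f \<in> borel_measurable M" "\<And>z. \<bar>f z\<bar> \<le> N" and \<rho>: "0 < \<rho>"
  shows "\<bar>smooth \<rho> f y - f y\<bar> \<le> 2 * D ^ 3 * ball_variation f y (2 * \<rho>)"
proof -
  define A where "A = ball_variation f y (2 * \<rho>)"
  define V where "V = measure M (ball y (2 * \<rho>))"
  define w where "w = smooth_weight \<rho> y"
  have w: "0 < w" "\<rho> * V \<le> 2 * D ^ 3 * w"
    using smooth_weight_pos[OF \<rho>] smooth_weight_lower[of \<rho> y y] \<rho> by (simp_all add: w_def V_def)
  have A: "0 \<le> A" unfolding A_def by (rule mean_value_abs_nonneg)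
  have "\<bar>\<integral>z. max 0 (\<rho> - dist y z) * (f z - f y) \<partial>M\<bar> \<le> \<rho> * (V * A)"
    unfolding V_def A_def using \<rho> by (intro ball_integral_bound[where N = N] f) (auto simp: indicator_def)
  also have "\<dots> \<le> 2 * D ^ 3 * A * w" using mult_right_mono[OF w(2) A] by (simp add: mult_ac)
  finally have "\<bar>\<integral>z. max 0 (\<rho> - dist y z) * (f z - f y) \<partial>M\<bar> / w \<le> 2 * D ^ 3 * A"
    using w(1) by (simp only: pos_divide_le_eq)
  then show ?thesis
    using w(1) by (simp only: smooth_minus_const[OF f \<rho>] w_def[symmetric] A_def abs_divide abs_of_pos)
qed

lemma smooth_local_lipschitz:
  assumes f: "f \<in> borel_measurable M" "\<And>z. \<bar>f z\<bar> \<le> N" and \<rho>: "0 < \<rho>" and d: "dist y y' < \<rho>"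
  shows "\<bar>smooth \<rho> f y' - smooth \<rho> f y\<bar>
    \<le> (2 * D ^ 3 + 4 * D ^ 6) / \<rho> * ball_variation f y (2 * \<rho>) * dist y y'"
proof -
  define A where "A = ball_variation f y (2 * \<rho>)"
  define V where "V = measure M (ball y (2 * \<rho>))"
  define w where "w = smooth_weight \<rho> y"
  define w' where "w' = smooth_weight \<rho> y'"
  define I where "I = (\<integral>z. max 0 (\<rho> - dist y z) * (f z - f y) \<partial>M)"
  define I' where "I' = (\<integral>z. max 0 (\<rho> - dist y' z) * (f z - f y) \<partial>M)"
  define \<delta> where "\<delta> = dist y y'"
  define K where "K = 2 * D ^ 3"
  have D6: "D ^ 6 = D ^ 3 * D ^ 3" by (simp flip: power_add)
  have \<delta>: "0 \<le> \<delta>" by (simp add: \<delta>_def)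
  have V: "0 < V" unfolding V_def using \<rho> by (intro measure_ball_pos) auto
  have K: "0 < K" using D_ge by (simp add: K_def)
  have w: "0 < w" "\<rho> * V \<le> K * w" and w': "0 < w'" "\<rho> * V \<le> K * w'"
    using smooth_weight_pos[OF \<rho>] smooth_weight_lower[of \<rho> y y] smooth_weight_lower[of \<rho> y y'] \<rho> d
    by (simp_all add: w_def w'_def V_def K_def)
  have A: "0 \<le> A" unfolding A_def by (rule mean_value_abs_nonneg)
  \<comment> \<open>The tent around \<open>y'\<close> stays inside
    \<open>ball y (2 * \<rho>)\<close>, so all integrals are estimated on this one ball.\<close>
  have supp: "dist y z < 2 * \<rho>" if "dist y' z \<le> \<rho>" for z
    using dist_triangle[of y z y'] that d by linarith
  have tent: "\<bar>max 0 (\<rho> - dist y z) - max 0 (\<rho> - dist y' z)\<bar> \<le> \<delta> * indicat_real (ball y (2 * \<rho>)) z" for z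
    using supp[of z] dist_triangle[of y z y'] dist_triangle[of y' z y] \<rho>
    by (auto simp: indicator_def \<delta>_def dist_commute max_def)
  have int: "integrable M (\<lambda>z. max 0 (\<rho> - dist u z))"
    "integrable M (\<lambda>z. max 0 (\<rho> - dist u z) * (f z - f y))" for u
  proof -
    show "integrable M (\<lambda>z. max 0 (\<rho> - dist u z))"
      using \<rho> by (intro integrable_bounded_ball[of _ \<rho> u \<rho>]) auto
    have "0 \<le> N" using f(2)[of y] by linarith
    moreover have "\<bar>f z - f y\<bar> \<le> 2 * N" for z using f(2)[of y] f(2)[of z] by linarith
    ultimately show "integrable M (\<lambda>z. max 0 (\<rho> - dist u z) * (f z - f y))"
      using \<rho> f(1) by (intro integrable_bounded_ball[of _ "\<rho> * (2 * N)" u \<rho>])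
        (auto simp: abs_mult intro!: mult_mono)
  qed
  have supp': "\<bar>max 0 (\<rho> - dist y' z)\<bar> \<le> \<rho> * indicat_real (ball y (2 * \<rho>)) z" for z
    using supp[of z] \<rho> by (simp add: indicator_def max_def)
  have I': "\<bar>I'\<bar> \<le> \<rho> * (V * A)"
    unfolding V_def A_def I'_def using \<rho> supp' by (intro ball_integral_bound[where N = N] f) auto
  have "I - I' = (\<integral>z. (max 0 (\<rho> - dist y z) - max 0 (\<rho> - dist y' z)) * (f z - f y) \<partial>M)"
    using int by (simp add: I_def I'_def left_diff_distrib)
  also have "\<bar>\<dots>\<bar> \<le> \<delta> * (V * A)"
    unfolding V_def A_def using \<rho> tent by (intro ball_integral_bound[where N = N] f) auto
  finally have II': "\<bar>I - I'\<bar> \<le> \<delta> * (V * A)" .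
  have "w - w' = (\<integral>z. (max 0 (\<rho> - dist y z) - max 0 (\<rho> - dist y' z)) \<partial>M)"
    using int by (simp add: w_def w'_def smooth_weight_def)
  also have "\<bar>\<dots>\<bar> \<le> (\<integral>z. \<delta> * indicat_real (ball y (2 * \<rho>)) z \<partial>M)"
  proof (rule order_trans[OF integral_abs_bound integral_mono])
    show "integrable M (\<lambda>z. \<delta> * indicat_real (ball y (2 * \<rho>)) z)"
      using ball_finite[of y "2 * \<rho>"] by (auto simp: sets_eq)
  qed (use tent int in auto)
  also have "\<dots> = \<delta> * V" by (simp add: sets_eq space_eq V_def)
  finally have ww': "\<bar>w - w'\<bar> \<le> \<delta> * V" .
  have "smooth \<rho> f y' - smooth \<rho> f y = (smooth \<rho> f y' - f y) - (smooth \<rho> f y - f y)" by simp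
  also have "\<dots> = I' / w' - I / w"
    by (simp only: smooth_minus_const[OF f \<rho>] I_def I'_def w_def w'_def)
  \<comment> \<open>Quotient rule: the change of the numerator and the change of the weight are
    separated, and each is at most a multiple of \<open>\<delta>\<close>.\<close>
  also have "\<dots> = (I' - I) / w + I' * (w - w') / (w * w')" using w w' by (simp add: field_simps)
  also have "\<bar>\<dots>\<bar> \<le> \<bar>I - I'\<bar> / w + \<bar>I'\<bar> * \<bar>w - w'\<bar> / (w * w')"
    using w w' by (intro order_trans[OF abs_triangle_ineq]) (simp add: abs_mult abs_minus_commute)
  also have "\<dots> \<le> \<delta> * (V * A) / w + (\<rho> * (V * A)) * (\<delta> * V) / (w * w')"
    using w w' II' I' ww' \<delta> \<rho> V A by (intro add_mono divide_right_mono mult_mono) auto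
  \<comment> \<open>Regrouped so that only the quotients \<open>\<rho> * V / w\<close> and
    \<open>\<rho> * V / w'\<close> remain, each at most \<open>K\<close> by doubling. Thus the
    constant is K + K^2.\<close>
  also have "\<dots> = \<delta> * A / \<rho> * ((\<rho> * V) / w + ((\<rho> * V) / w) * ((\<rho> * V) / w'))"
    using w w' \<rho> by (simp add: field_simps)
  also have "\<dots> \<le> \<delta> * A / \<rho> * (K + K * K)"
    using w w' \<delta> \<rho> A K V
    by (intro mult_left_mono add_mono mult_mono) (auto simp: pos_divide_le_eq)
  also have "\<dots> = (2 * D ^ 3 + 4 * D ^ 6) / \<rho> * A * \<delta>"
    unfolding K_def D6 by (simp add: algebra_simps add_divide_distrib)
  finally show ?thesis by (simp add: A_def \<delta>_def)
qed

text \<open>With \<rho> = r / 2 the local Lipschitz constant becomes \<open>smooth_const / r\<close>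
  times the variation. The same number dominates the factor 2 D^3 of \<open>smooth_approx\<close>,
  so one constant serves both estimates.\<close>

definition smooth_const :: real where
  "smooth_const = 4 * D ^ 3 + 8 * D ^ 6"

lemma smooth_const_pos: "0 < smooth_const"
  unfolding smooth_const_def using D_ge by (intro add_pos_pos) auto

text \<open>Close points are handled by the local estimate, distant ones by boundedness. Global
  Lipschitz continuity is what admits the smoothed function to the Poincare inequality.\<close>

lemma smooth_lipschitz:
  assumes f: "f \<in> borel_measurable M" "\<And>z. \<bar>f z\<bar> \<le> N" and \<rho>: "0 < \<rho>"
  shows "\<exists>L. L-lipschitz_on UNIV (smooth \<rho> f)"
proof -
  define K where "K = (2 * D ^ 3 + 4 * D ^ 6) / \<rho> * (2 * N)"
  \<comment> \<open>The smoothing differs from \<open>f\<close> by at most 4 D^3 N and |f| <= N, so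
    two of its values differ by at most \<open>K' * \<rho>\<close>.\<close>
  define K' where "K' = (8 * D ^ 3 * N + 2 * N) / \<rho>"
  have N: "0 \<le> N" using f(2)[of undefined] by linarith
  have D: "0 \<le> D" using D_ge by simp
  have var: "ball_variation f y (2 * \<rho>) \<le> 2 * N" for y using \<rho> by (intro ball_variation_le f) auto
  have "\<bar>smooth \<rho> f y' - smooth \<rho> f y\<bar> \<le> max K K' * dist y y'" for y y'
  proof (cases "dist y y' < \<rho>")
    case True
    have "\<bar>smooth \<rho> f y' - smooth \<rho> f y\<bar>
        \<le> (2 * D ^ 3 + 4 * D ^ 6) / \<rho> * ball_variation f y (2 * \<rho>) * dist y y'"
      by (rule smooth_local_lipschitz[OF f \<rho> True])
    also have "\<dots> \<le> K * dist y y'"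
      unfolding K_def using var \<rho> D by (intro mult_right_mono mult_left_mono) auto
    also have "\<dots> \<le> max K K' * dist y y'" by (intro mult_right_mono) auto
    finally show ?thesis .
  next
    case False
    have s: "\<bar>smooth \<rho> f u - f u\<bar> \<le> 4 * D ^ 3 * N" for u
      using order_trans[OF smooth_approx[OF f \<rho>, of u] mult_left_mono[OF var[of u]]] D by simp
    have "\<bar>smooth \<rho> f y' - smooth \<rho> f y\<bar> \<le> K' * \<rho>"
      using s[of y] s[of y'] f(2)[of y] f(2)[of y'] \<rho> unfolding K'_def by (simp add: abs_le_iff)
    also have "\<dots> \<le> K' * dist y y'"
      using False N D \<rho> by (intro mult_left_mono) (auto simp: K'_def)
    also have "\<dots> \<le> max K K' * dist y y'" by (intro mult_right_mono) auto
    finally show ?thesis .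
  qed
  moreover have "0 \<le> max K K'" using N D \<rho> by (auto simp: K'_def le_max_iff_disj)
  ultimately show ?thesis
    by (intro exI[of _ "max K K'"] lipschitz_onI) (auto simp: dist_real_def dist_commute)
qed

section \<open>Energy bounds for the smoothing\<close>

text \<open>Jensen on each ball bounds the power of the variation by the inner average of the
  energy; r^p offsets the factor 1 / r^p in the energy.\<close>

lemma nn_integral_powr_le_KS_energy:
  assumes p: "1 \<le> p" and f[measurable]: "f \<in> borel_measurable M" and r: "0 < r" and b: "0 < b"
    and g: "\<And>y. 0 \<le> g y" "\<And>y. g y \<le> b * ball_variation f y r"
  shows "(\<integral>\<^sup>+y\<in>U. ennreal (g y powr p) \<partial>M) \<le> ennreal ((b * r) powr p) * KS_energy p M r f U"
proof -
  let ?I = "\<lambda>y. (\<integral>\<^sup>+z\<in>ball y r. ennreal (\<bar>f z - f y\<bar> powr p) \<partial>M) / emeasure M (ball y r)"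
  have pw: "ennreal (g y powr p) \<le> ennreal (b powr p) * ?I y" for y
  proof -
    have "g y powr p \<le> (b * ball_variation f y r) powr p"
      using g p by (intro powr_mono2) auto
    also have "\<dots> = b powr p * ball_variation f y r powr p"
      using b mean_value_abs_nonneg by (intro powr_mult)
    finally have "ennreal (g y powr p) \<le> ennreal (b powr p) * ennreal (ball_variation f y r powr p)"
      by (simp add: ennreal_leI flip: ennreal_mult)
    also have "\<dots> \<le> ennreal (b powr p) * ?I y"
      using ball_pos[OF r] ball_finite
      by (intro mult_left_mono mean_value_powr_le p) (auto simp: sets_eq)
    finally show ?thesis .
  qed
  have "(\<integral>\<^sup>+y\<in>U. ennreal (g y powr p) \<partial>M) \<le> (\<integral>\<^sup>+y. ennreal (b powr p) * (?I y * indicator U y) \<partial>M)"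
    using pw by (intro nn_integral_mono) (auto simp: indicator_def)
  also have "\<dots> \<le> ennreal (b powr p) * (\<integral>\<^sup>+y\<in>U. ?I y \<partial>M)"
    using b by (intro nn_integral_cmult_le) auto
  also have "ennreal (b powr p) = ennreal ((b * r) powr p) * ennreal (1 / r powr p)"
    using b r by (simp add: powr_mult flip: ennreal_mult)
  finally show ?thesis by (simp add: KS_energy_def mult.assoc)
qed

text \<open>Taking \<open>b = smooth_const / r\<close> cancels the scale, so the constant is uniform
  in \<open>r\<close>.\<close>

lemma smooth_Lip_energy:
  assumes p: "1 \<le> p" and f: "f \<in> borel_measurable M" "\<And>z. \<bar>f z\<bar> \<le> N" and r: "0 < r"
  shows "(\<integral>\<^sup>+y\<in>U. ennreal (enn2real (pointwise_Lip (smooth (r / 2) f) y) powr p) \<partial>M)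
    \<le> ennreal (smooth_const powr p) * KS_energy p M r f U"
proof -
  have "enn2real (pointwise_Lip (smooth (r / 2) f) y) \<le> smooth_const / r * ball_variation f y r" for y
  proof (rule enn2real_leI)
    show nn: "0 \<le> smooth_const / r * ball_variation f y r"
      using r smooth_const_pos mean_value_abs_nonneg by (intro mult_nonneg_nonneg) auto
    show "pointwise_Lip (smooth (r / 2) f) y \<le> ennreal (smooth_const / r * ball_variation f y r)"
    proof (rule pointwise_Lip_le[OF _ nn])
      show "\<bar>smooth (r / 2) f y' - smooth (r / 2) f y\<bar> \<le> smooth_const / r * ball_variation f y r * dist y y'"
        if "dist y y' < r / 2" for y'
        using smooth_local_lipschitz[OF f _ that] r
        by (simp add: smooth_const_def add_divide_distrib)
    qed (use r in auto)
  qed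
  then show ?thesis
    using nn_integral_powr_le_KS_energy[OF p f(1) r, of "smooth_const / r"] smooth_const_pos r by simp
qed

text \<open>Here \<open>b = smooth_const\<close>, and the remaining r^p becomes R^p once r <=
  R.\<close>

lemma smooth_Lp_energy:
  assumes p: "1 \<le> p" and f: "f \<in> borel_measurable M" "\<And>z. \<bar>f z\<bar> \<le> N" and r: "0 < r"
  shows "(\<integral>\<^sup>+y\<in>U. ennreal (\<bar>f y - smooth (r / 2) f y\<bar> powr p) \<partial>M)
    \<le> ennreal ((smooth_const * r) powr p) * KS_energy p M r f U"
proof (rule nn_integral_powr_le_KS_energy[OF p f(1) r smooth_const_pos])
  fix y
  have "\<bar>f y - smooth (r / 2) f y\<bar> \<le> 2 * D ^ 3 * ball_variation f y r"
    using smooth_approx[OF f, of "r / 2" y] r by (simp add: abs_minus_commute)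
  also have "\<dots> \<le> smooth_const * ball_variation f y r"
    unfolding smooth_const_def using D_ge mean_value_abs_nonneg by (intro mult_right_mono) auto
  finally show "\<bar>f y - smooth (r / 2) f y\<bar> \<le> smooth_const * ball_variation f y r" .
qed simp

section \<open>The Poincare inequality at a fixed scale\<close>

text \<open>From \<open>f\<close> one passes to its truncation, to the truncation \<open>u\<close>
  of \<open>g\<close>, to the smoothing \<open>h\<close> of \<open>u\<close>, and to a constant. The
  first two differences are error terms; the third is controlled by the energy, the fourth by the
  Poincare inequality for \<open>h\<close>.\<close>

lemma oscillation_le_KS_energy:
  assumes p: "1 \<le> p" and f: "f \<in> Lp_space p M" and g: "g \<in> borel_measurable M"
    and C: "0 < C" and \<Lambda>: "1 \<le> \<Lambda>"
    and PI: "\<And>h L. L-lipschitz_on UNIV h \<Longrightarrow>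
      oscillation M p (ball x R) h \<le> ennreal (C * R powr p) *
        (\<integral>\<^sup>+y\<in>ball x (\<Lambda> * R). ennreal (enn2real (pointwise_Lip h y) powr p) \<partial>M)"
    and r: "0 < r" "r \<le> R" and N: "0 \<le> N"
  shows "oscillation M p (ball x R) f
    \<le> ennreal (2 * 4 powr p * 4 powr p) *
        ((\<integral>\<^sup>+y. ennreal (\<bar>f y - clip N (f y)\<bar> powr p) \<partial>M) + (\<integral>\<^sup>+y. ennreal (\<bar>g y - f y\<bar> powr p) \<partial>M))
      + ennreal (2 * 4 powr p * 4 powr p * smooth_const powr p * (1 + C) * R powr p) *
        KS_energy p M r g (ball x (\<Lambda> * R))"
proof -
  define B where "B = ball x R"
  define u where "u = (\<lambda>y. clip N (g y))"
  define h where "h = smooth (r / 2) u"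
  \<comment> \<open>With the mean value of \<open>h\<close>, rather than of \<open>f\<close>, the
    last difference is exactly the oscillation of \<open>h\<close>.\<close>
  define c where "c = mean_value M B h"
  define E where "E = KS_energy p M r g (ball x (\<Lambda> * R))"
  define a where "a = (\<integral>\<^sup>+y. ennreal (\<bar>f y - clip N (f y)\<bar> powr p) \<partial>M)"
  define b where "b = (\<integral>\<^sup>+y. ennreal (\<bar>g y - f y\<bar> powr p) \<partial>M)"
  define s where "s = smooth_const powr p * R powr p"
  define q where "q = (4::real) powr p"
  have s: "0 \<le> s" and q: "0 \<le> q" by (simp_all add: s_def q_def)
  note g[measurable]
  have f_meas[measurable]: "f \<in> borel_measurable M" using f by (simp add: Lp_space_def)
  have B[measurable]: "B \<in> sets M" by (simp add: B_def sets_eq)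
  have u[measurable]: "u \<in> borel_measurable M" by (simp add: u_def)
  have uN: "\<bar>u y\<bar> \<le> N" for y unfolding u_def by (rule abs_clip_le[OF N])
  obtain L where L: "L-lipschitz_on UNIV h"
    using smooth_lipschitz[OF u uN, of "r / 2"] r by (auto simp: h_def)
  have h[measurable]: "h \<in> borel_measurable M"
    using borel_measurable_continuous_onI[OF lipschitz_on_continuous_on[OF L]] by simp
  have "0 < R" using r by simp
  have BU: "B \<subseteq> ball x (\<Lambda> * R)"
    unfolding B_def using mult_right_mono[OF \<Lambda>, of R] \<open>0 < R\<close> by (intro subset_ball) simp
  have E: "KS_energy p M r u V \<le> E" if "V \<subseteq> ball x (\<Lambda> * R)" for V
    unfolding u_def E_def using p that by (intro order_trans[OF KS_energy_clip_le KS_energy_mono]) auto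
  have uh: "(\<integral>\<^sup>+y\<in>B. ennreal (\<bar>u y - h y\<bar> powr p) \<partial>M) \<le> ennreal s * E"
  proof -
    have "(\<integral>\<^sup>+y\<in>B. ennreal (\<bar>u y - h y\<bar> powr p) \<partial>M) \<le> ennreal ((smooth_const * r) powr p) * KS_energy p M r u B"
      unfolding h_def by (rule smooth_Lp_energy[OF p u uN r(1)])
    also have "\<dots> \<le> ennreal s * E"
    proof (intro mult_mono ennreal_leI E BU)
      have "(smooth_const * r) powr p \<le> (smooth_const * R) powr p"
        using smooth_const_pos r p by (intro powr_mono2) auto
      also have "\<dots> = s" unfolding s_def using smooth_const_pos \<open>0 < R\<close> by (intro powr_mult)
      finally show "(smooth_const * r) powr p \<le> s" .
    qed auto
    finally show ?thesis .
  qed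
  have hc: "(\<integral>\<^sup>+y\<in>B. ennreal (\<bar>h y - c\<bar> powr p) \<partial>M) \<le> ennreal (C * s) * E"
  proof -
    have "(\<integral>\<^sup>+y\<in>B. ennreal (\<bar>h y - c\<bar> powr p) \<partial>M)
      \<le> ennreal (C * R powr p) * (\<integral>\<^sup>+y\<in>ball x (\<Lambda> * R). ennreal (enn2real (pointwise_Lip h y) powr p) \<partial>M)"
      using PI[OF L] by (simp add: oscillation_def c_def B_def)
    also have "\<dots> \<le> ennreal (C * R powr p) * (ennreal (smooth_const powr p) * KS_energy p M r u (ball x (\<Lambda> * R)))"
      unfolding h_def by (intro mult_left_mono smooth_Lip_energy[OF p u uN r(1)]) auto
    also have "\<dots> \<le> ennreal (C * R powr p) * (ennreal (smooth_const powr p) * E)"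
      by (intro mult_left_mono E) auto
    also have "\<dots> = ennreal (C * s) * E"
      using C by (simp add: s_def ennreal_mult mult_ac)
    finally show ?thesis .
  qed
  have pw: "ennreal (\<bar>f y - c\<bar> powr p) \<le> ennreal q *
      (ennreal (\<bar>f y - clip N (f y)\<bar> powr p) + ennreal (\<bar>g y - f y\<bar> powr p)
        + ennreal (\<bar>u y - h y\<bar> powr p) + ennreal (\<bar>h y - c\<bar> powr p))" for y
  proof -
    \<comment> \<open>Truncation is a contraction, so the step from \<open>clip N (f y)\<close> to
      \<open>u y\<close> costs at most |g y - f y|.\<close>
    have "\<bar>f y - c\<bar> powr p
      \<le> (\<bar>f y - clip N (f y)\<bar> + \<bar>g y - f y\<bar> + \<bar>u y - h y\<bar> + \<bar>h y - c\<bar>) powr p"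
      using p clip_contraction[of N "g y" "f y"] by (intro powr_mono2) (auto simp: u_def)
    also have "\<dots> \<le> q * (\<bar>f y - clip N (f y)\<bar> powr p + \<bar>g y - f y\<bar> powr p
        + \<bar>u y - h y\<bar> powr p + \<bar>h y - c\<bar> powr p)"
      unfolding q_def using p by (intro powr_sum4_le) auto
    finally show ?thesis
      using q by (simp add: ennreal_leI flip: ennreal_mult ennreal_plus)
  qed
  \<comment> \<open>The indicator is dropped from the two error terms, whose integrals over the
    whole space vanish in the limit.\<close>
  have "(\<integral>\<^sup>+y\<in>B. ennreal (\<bar>f y - c\<bar> powr p) \<partial>M)
      \<le> (\<integral>\<^sup>+y. ennreal q *
          (ennreal (\<bar>f y - clip N (f y)\<bar> powr p) + ennreal (\<bar>g y - f y\<bar> powr p)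
          + ennreal (\<bar>u y - h y\<bar> powr p) * indicator B y + ennreal (\<bar>h y - c\<bar> powr p) * indicator B y) \<partial>M)"
    using pw by (intro nn_integral_mono) (auto simp: indicator_def)
  also have "\<dots> = ennreal q * (a + b + (\<integral>\<^sup>+y\<in>B. ennreal (\<bar>u y - h y\<bar> powr p) \<partial>M)
      + (\<integral>\<^sup>+y\<in>B. ennreal (\<bar>h y - c\<bar> powr p) \<partial>M))"
    by (simp add: nn_integral_cmult nn_integral_add a_def b_def)
  also have "\<dots> \<le> ennreal q * (a + b + ennreal s * E + ennreal (C * s) * E)"
    by (intro mult_left_mono add_mono uh hc) auto
  also have "\<dots> = ennreal q * (a + b + ennreal (s * (1 + C)) * E)"
    using s C by (simp add: distrib_left ennreal_plus add.assoc mult.commute[of C] flip: distrib_right)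
  finally have fc: "(\<integral>\<^sup>+y\<in>B. ennreal (\<bar>f y - c\<bar> powr p) \<partial>M)
    \<le> ennreal q * (a + b + ennreal (s * (1 + C)) * E)" .
  have "oscillation M p B f \<le> ennreal (2 * q) * (\<integral>\<^sup>+y\<in>B. ennreal (\<bar>f y - c\<bar> powr p) \<partial>M)"
    unfolding q_def using ball_pos[OF \<open>0 < R\<close>, of x] ball_finite[of x R]
    by (intro oscillation_le[OF p f_meas B] Lp_set_integrable[OF p f B]) (auto simp: B_def)
  also have "\<dots> \<le> ennreal (2 * q) * (ennreal q * (a + b + ennreal (s * (1 + C)) * E))"
    by (intro mult_left_mono fc) auto
  also have "\<dots> = ennreal (2 * q * q) * (a + b) + ennreal (2 * q * q * (s * (1 + C))) * E"
  proof -
    have "ennreal (2 * q) * (ennreal q * (z + ennreal t * E)) = ennreal (2 * q * q) * z + ennreal (2 * q * q * t) * E"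
      if "0 \<le> t" for z t
      using q that by (simp add: ennreal_mult distrib_left mult_ac)
    then show ?thesis using s C by simp
  qed
  finally show ?thesis
    by (simp add: a_def b_def q_def s_def E_def B_def mult_ac)
qed

end

section \<open>Passage to the limit\<close>

text \<open>Doubling at radius \<open>r / 2\<close> gives both positivity and finiteness of the ball
  of radius \<open>r\<close>.\<close>

lemma volume_doubling_imp_doubling:
  assumes "sets M = sets borel" "volume_doubling M"
  shows "\<exists>D. doubling M D"
proof -
  obtain C where C: "0 < C" and vd: "\<And>x r. 0 < r \<Longrightarrow> 0 < emeasure M (ball x (2 * r)) \<and>
      emeasure M (ball x (2 * r)) \<le> ennreal C * emeasure M (ball x r) \<and>
      ennreal C * emeasure M (ball x r) < \<infinity>"
    using assms(2) unfolding volume_doubling_def by blast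
  have pos: "0 < emeasure M (ball x r)" if "0 < r" for x r
    using vd[of "r / 2" x] that by simp
  have fin: "emeasure M (ball x r) < \<infinity>" for x r
  proof (cases "0 < r")
    case True
    then show ?thesis
      using vd[of "r / 2" x] by (auto intro: le_less_trans)
  next
    case False
    then show ?thesis by (simp add: ball_empty)
  qed
  have eq: "emeasure M (ball x r) = ennreal (measure M (ball x r))" for x r
    using fin[of x r] by (intro emeasure_eq_ennreal_measure) (simp add: less_top)
  have "doubling M (max 1 C)"
  proof
    fix x :: 'a and r :: real assume r: "0 < r"
    have "ennreal (measure M (ball x (2 * r))) \<le> ennreal (C * measure M (ball x r))"
      using vd[OF r, of x] C by (simp add: eq ennreal_mult)
    then have "measure M (ball x (2 * r)) \<le> C * measure M (ball x r)"
      using C by (simp add: ennreal_le_iff)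
    also have "\<dots> \<le> max 1 C * measure M (ball x r)" by (intro mult_right_mono) auto
    finally show "measure M (ball x (2 * r)) \<le> max 1 C * measure M (ball x r)" .
  qed (use assms pos fin in auto)
  then show ?thesis ..
qed

theorem proposition4p14:
  fixes M :: "'a::complete_space measure"
    and p :: real
    and r :: "nat \<Rightarrow> real"
    and \<Gamma> :: "('a \<Rightarrow> real) \<Rightarrow> 'a set \<Rightarrow> ereal"
  assumes "1 \<le> p"
    and "cheeger_space p M"
    and "\<And>n. r n > 0"
    and "r \<longlonglongrightarrow> 0"
    and "gamma_bar_converges p M (\<lambda>n f U. enn2ereal (KS_energy p M (r n) f U)) \<Gamma>"
    and "\<exists>G. gamma_converges p M (\<lambda>n f. enn2ereal (KS_energy p M (r n) f UNIV)) G"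
  shows "\<exists>C>0::real. \<exists>\<Lambda>>1::real. \<forall>f\<in>KS_space p M. \<forall>x. \<forall>R>0.
           enn2ereal (oscillation M p (ball x R) f)
             \<le> ereal (C * R powr p) * \<Gamma> f (ball x (\<Lambda> * R))"
proof -
  have "sets M = sets borel" "volume_doubling M"
    using assms(2) by (simp_all add: cheeger_space_def radon_measure_def)
  then obtain D where "doubling M D"
    using volume_doubling_imp_doubling by blast
  then interpret doubling M D .
  obtain C \<Lambda> where C: "0 < C" and \<Lambda>: "1 \<le> \<Lambda>" and PI: "\<And>h L x R. L-lipschitz_on UNIV h \<Longrightarrow> 0 < R \<Longrightarrow>
      oscillation M p (ball x R) h \<le> ennreal (C * R powr p) *
        (\<integral>\<^sup>+y\<in>ball x (\<Lambda> * R). ennreal (enn2real (pointwise_Lip h y) powr p) \<partial>M)"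
    using assms(2) unfolding cheeger_space_def poincare_inequality_def by blast
  \<comment> \<open>In \<open>q\<close>, 2 * 4^p comes from exchanging the mean value and the second
    4^p from the four-term splitting. In 1 + C, the 1 belongs to the smoothing error and
    \<open>C\<close> to the Poincare inequality.\<close>
  define q where "q = 2 * 4 powr p * (4::real) powr p"
  define K where "K = q * smooth_const powr p * (1 + C)"
  have q: "0 < q" by (simp add: q_def)
  have K: "0 < K" unfolding K_def using q C smooth_const_pos by (intro mult_pos_pos) auto
  have "enn2ereal (oscillation M p (ball x R) f) \<le> ereal (K * R powr p) * \<Gamma> f (ball x ((2 * \<Lambda>) * R))"
    if f: "f \<in> KS_space p M" and R: "0 < R" for f x R
  proof -
    have fL: "f \<in> Lp_space p M" using f by (simp add: KS_space_def)
    \<comment> \<open>A recovery sequence controls the energy on \<open>U\<close> by the limit on a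
      larger set, hence the doubled dilation, which also exceeds 1.\<close>
    define U where "U = ball x (\<Lambda> * R)"
    define V where "V = ball x ((2 * \<Lambda>) * R)"
    have "closure U \<subseteq> cball x (\<Lambda> * R)"
      unfolding U_def by (intro closure_minimal ball_subset_cball closed_cball)
    moreover have "cball x (\<Lambda> * R) \<subseteq> V"
    proof
      fix y assume "y \<in> cball x (\<Lambda> * R)"
      moreover have "0 < \<Lambda> * R" using \<Lambda> R by simp
      ultimately show "y \<in> V" unfolding V_def mem_ball mem_cball mult.assoc by linarith
    qed
    moreover have "compact (cball x (\<Lambda> * R))" by (rule doubling_compact_cball) fact
    ultimately have UV: "compactly_contained U V"
      unfolding compactly_contained_def
      using compact_Int_closed[of "cball x (\<Lambda> * R)" "closure U"] by (simp add: Int_absorb1 order_trans)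
    have "\<exists>g. Lp_converges p M g f \<and> limsup (\<lambda>n. enn2ereal (KS_energy p M (r n) (g n) U)) \<le> \<Gamma> f V"
      using assms(5)[unfolded gamma_bar_converges_def, THEN conjunct2, THEN conjunct1] fL UV
      by (simp add: U_def V_def)
    then obtain g where g: "Lp_converges p M g f"
      and lim: "limsup (\<lambda>n. enn2ereal (KS_energy p M (r n) (g n) U)) \<le> \<Gamma> f V"
      by blast
    have gm: "g n \<in> borel_measurable M" for n using g by (auto simp: Lp_converges_def Lp_space_def)
    \<comment> \<open>The truncation height is tied to the index of the recovery sequence, so a
      single limit removes both errors.\<close>
    define a where "a n = ennreal q * ((\<integral>\<^sup>+y. ennreal (\<bar>f y - clip (real n) (f y)\<bar> powr p) \<partial>M)
      + (\<integral>\<^sup>+y. ennreal (\<bar>g n y - f y\<bar> powr p) \<partial>M))" for n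
    define E where "E n = KS_energy p M (r n) (g n) U" for n
    have "a \<longlonglongrightarrow> ennreal q * (0 + 0)"
      unfolding a_def using g assms(1) fL
      by (intro ennreal_tendsto_cmult tendsto_add nn_integral_clip_error_tendsto_0) (auto simp: Lp_converges_def)
    then have "(\<lambda>n. enn2ereal (a n)) \<longlonglongrightarrow> 0"
      using continuous_on_tendsto_compose[OF continuous_on_enn2ereal, of a 0 sequentially]
      by (simp add: zero_ennreal.rep_eq)
    then have a0: "limsup (\<lambda>n. enn2ereal (a n)) = 0" by (rule lim_imp_Limsup[rotated]) simp
    have "\<forall>\<^sub>F n in sequentially. r n < R" using assms(4) R by (rule order_tendstoD(2))
    then have "\<forall>\<^sub>F n in sequentially. enn2ereal (oscillation M p (ball x R) f)
        \<le> enn2ereal (a n) + ereal (K * R powr p) * enn2ereal (E n)"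
    proof eventually_elim
      case (elim n)
      have "oscillation M p (ball x R) f \<le> a n + ennreal (K * R powr p) * E n"
        unfolding a_def E_def K_def q_def U_def
        using assms(3)[of n] elim R
        by (intro oscillation_le_KS_energy assms(1) fL gm C \<Lambda> PI) auto
      then have "enn2ereal (oscillation M p (ball x R) f) \<le> enn2ereal (a n + ennreal (K * R powr p) * E n)"
        by (simp add: less_eq_ennreal.rep_eq)
      then show ?case
        using K by (simp add: plus_ennreal.rep_eq times_ennreal.rep_eq enn2ereal_ennreal)
    qed
    then have "enn2ereal (oscillation M p (ball x R) f)
        \<le> limsup (\<lambda>n. enn2ereal (a n) + ereal (K * R powr p) * enn2ereal (E n))"
      using Limsup_mono[of "\<lambda>_. enn2ereal (oscillation M p (ball x R) f)" _ sequentially]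
      by (simp add: Limsup_const)
    also have "\<dots> \<le> limsup (\<lambda>n. enn2ereal (a n)) + limsup (\<lambda>n. ereal (K * R powr p) * enn2ereal (E n))"
      by (rule ereal_limsup_add_mono)
    \<comment> \<open>The error part has upper limit 0, and a finite nonnegative factor passes
      through the upper limit.\<close>
    also have "\<dots> = ereal (K * R powr p) * limsup (\<lambda>n. enn2ereal (E n))"
      using K by (simp add: a0 limsup_ereal_mult_left)
    also have "\<dots> \<le> ereal (K * R powr p) * \<Gamma> f V"
      using lim K unfolding E_def by (intro ereal_mult_left_mono) auto
    finally show ?thesis unfolding V_def .
  qed
  then show ?thesis using K \<Lambda> by (intro exI[of _ K] conjI exI[of _ "2 * \<Lambda>"]) auto
qed

end
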